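(* Let $\Omega\ge 1$. Let $\{(\rho^j,p^j,q^j,\lambda^j,\mu^j)\}_{j=1}^\infty$ be a sequence of static shell solutions of the spherically symmetric Einstein equations (as defined in the context), the $j$-th one with matter supported in $[R_0^j,R_1^j]$, $0<R_0^j<R_1^j$, such that $\rho^j\ge 0$, $p^j\ge 0$ and $p^j+q^j\le\Omega\rho^j$ for every $j$, and such that $$\lim_{j\to\infty}\frac{R_1^j}{R_0^j}=1.$$ Let $M^j=\int_0^\infty 4\pi\eta^2\rho^j(\eta)\,d\eta$ be the ADM mass of the $j$-th solution. Then $$\limsup_{j\to\infty}\frac{2M^j}{R_1^j}\le\frac{(2\Omega+1)^2-1}{(2\Omega+1)^2}.$$
   Context: The metric of a static spherically symmetric spacetime in Schwarzschild coordinates is $ds^2=-e^{2\mu(r)}dt^2+e^{2\lambda(r)}dr^2+r^2(d\theta^2+\sin^2\theta\,d\varphi^2)$, $r\ge 0$. A static shell solution supported in $[R_0,R_1]$ (with $0<R_0<R_1$) consists of real-valued functions $\rho$ (energy density), $p$ (radial pressure), $q$ (tangential pressure, normalized so that isotropic pressure means $q=2p$), and metric functions $\lambda,\mu$ on $[0,\infty)$, with $\lambda\in C^1$, $\mu\in C^2$ and $\rho,p,q$ continuous, such that $\rho,p,q$ vanish outside $[R_0,R_1]$ and the Einstein equations hold for all $r>0$ (subscript $r$ denotes $d/dr$): $$e^{-2\lambda}(2r\lambda_r-1)+1=8\pi r^2\rho,$$ $$e^{-2\lambda}(2r\mu_r+1)-1=8\pi r^2p,$$ $$\mu_{rr}+(\mu_r-\lambda_r)\left(\mu_r+\frac1r\right)=4\pi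 q e^{2\lambda},$$ together with the asymptotic flatness conditions $\lim_{r\to\infty}\lambda(r)=\lim_{r\to\infty}\mu(r)=0$ and the regular centre condition $\lambda(0)=0$. No field equations for the matter are assumed beyond these. *)

theory Defs
  imports "HOL-Analysis.Analysis"
begin

text \<open>
  Class \<open>C\<^sup>k\<close> relative to a set. Derivatives are taken within \<open>S\<close>, hence one-sided at the
  endpoint \<open>0\<close> when \<open>S = {0..}\<close>; the library's \<open>C1_differentiable_on\<close> would require
  a two-sided derivative there.
\<close>

fun Ck_on :: "nat \<Rightarrow> real set \<Rightarrow> (real \<Rightarrow> real) \<Rightarrow> bool" where
  "Ck_on 0 S f \<longleftrightarrow> continuous_on S f"
| "Ck_on (Suc k) S f \<longleftrightarrow>
     (\<exists>f'. (\<forall>x\<in>S. (f has_real_derivative f' x) (at x within S)) \<and> Ck_on k S f')"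

text \<open>
  Static spherically symmetric shells for the metric
  \<open>ds\<^sup>2 = - e\<^bsup>2\<mu>(r)\<^esup> dt\<^sup>2 + e\<^bsup>2\<lambda>(r)\<^esup> dr\<^sup>2 + r\<^sup>2 (d\<theta>\<^sup>2 + sin\<^sup>2\<theta> d\<phi>\<^sup>2)\<close>, with matter supported in
  \<open>[R0, R1]\<close>: \<open>\<rho>\<close> is the energy density, \<open>p\<close> the radial pressure, and \<open>q\<close> the tangential
  pressure, normalized so that isotropic pressure means \<open>q = 2 p\<close>. All functions live on the
  half-line \<open>r \<ge> 0\<close>; their values at negative arguments are unconstrained. The last three
  assumptions are asymptotic flatness and the regular centre condition.
\<close>

locale static_shell =
  fixes R0 R1 :: real
    and \<rho> p q lam \<mu> :: "real \<Rightarrow> real"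
  assumes radii: "0 < R0" "R0 < R1"
    and lam_C1: "Ck_on 1 {0..} lam"
    and \<mu>_C2: "Ck_on 2 {0..} \<mu>"
    and matter_continuous:
      "continuous_on {0..} \<rho>" "continuous_on {0..} p" "continuous_on {0..} q"
    and matter_support:
      "\<And>r. r \<ge> 0 \<Longrightarrow> r \<notin> {R0..R1} \<Longrightarrow> \<rho> r = 0 \<and> p r = 0 \<and> q r = 0"
    and einstein_\<rho>:
      "\<And>r. r > 0 \<Longrightarrow>
         exp (- 2 * lam r) * (2 * r * deriv lam r - 1) + 1 = 8 * pi * r\<^sup>2 * \<rho> r"
    and einstein_p:
      "\<And>r. r > 0 \<Longrightarrow>
         exp (- 2 * lam r) * (2 * r * deriv \<mu> r + 1) - 1 = 8 * pi * r\<^sup>2 * p r"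
    and einstein_q:
      "\<And>r. r > 0 \<Longrightarrow>
         deriv (deriv \<mu>) r + (deriv \<mu> r - deriv lam r) * (deriv \<mu> r + 1 / r)
           = 4 * pi * q r * exp (2 * lam r)"
    and lam_at_infinity: "(lam \<longlongrightarrow> 0) at_top"
    and \<mu>_at_infinity: "(\<mu> \<longlongrightarrow> 0) at_top"
    and regular_centre: "lam 0 = 0"

definition adm_mass :: "(real \<Rightarrow> real) \<Rightarrow> real" where
  "adm_mass \<rho> = integral {0..} (\<lambda>\<eta>. 4 * pi * \<eta>\<^sup>2 * \<rho> \<eta>)"

end

theory Submission
  imports Defs
begin

text \<open>
  Put \<open>k = \<Omega> + 1\<close> and \<open>W = exp (- \<lambda>) * (r * \<mu>\<^sub>r + k)\<close>. The Einstein equations and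
  \<open>p + q \<le> \<Omega> * \<rho>\<close> give
  \<open>r * exp \<lambda> * W\<^sub>r \<le> k / 2 * (exp (2 * \<lambda>) - 1) - r * \<mu>\<^sub>r - (r * \<mu>\<^sub>r)\<^sup>2\<close>, and the right-hand
  side is nonpositive wherever \<open>W > k\<close>. Since \<open>W = k\<close> at the centre, \<open>W \<le> k\<close> everywhere.
  In the vacuum outside the shell this says \<open>exp \<lambda> \<le> 2 * \<Omega> + 1\<close>, where
  \<open>exp (- 2 * \<lambda>) = 1 - 2 * M / r\<close>.
\<close>

text \<open>Connects the one-sided derivatives in \<open>Ck_on\<close> with the two-sided
  \<open>deriv\<close> of the Einstein equations.\<close>

lemma has_real_derivative_at_of_within_atLeast:
  fixes f :: "real \<Rightarrow> real"
  assumes "(f has_real_derivative D) (at x within {0..})" "x > 0"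
  shows "(f has_real_derivative D) (at x)"
proof -
  have "(f has_real_derivative D) (at x within {0<..})"
    using assms(1) by (rule DERIV_subset) auto
  then show ?thesis
    using assms(2) by (simp add: at_within_open[of x "{0<..}"])
qed

text \<open>If \<open>f b > c\<close>, take the last point of \<open>{a..b}\<close> where
  \<open>f\<close> is at most \<open>c\<close>. Beyond it \<open>f\<close> stays above
  \<open>c\<close>, hence is nonincreasing, and cannot have risen to \<open>f b\<close>.\<close>

lemma barrier_le:
  fixes f f' :: "real \<Rightarrow> real"
  assumes cont: "continuous_on {a..} f" and init: "f a \<le> c" and "a \<le> b"
    and deriv: "\<And>x. x > a \<Longrightarrow> (f has_real_derivative f' x) (at x)"
    and decr: "\<And>x. x > a \<Longrightarrow> f x > c \<Longrightarrow> f' x \<le> 0"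
  shows "f b \<le> c"
proof (rule ccontr)
  assume "\<not> f b \<le> c"
  define S where "S = {x \<in> {a..b}. f x \<le> c}"
  have "closed S"
    unfolding S_def
    by (intro continuous_on_closed_Collect_le continuous_intros continuous_on_subset[OF cont]) auto
  moreover have "a \<in> S" "bdd_above S"
    using init \<open>a \<le> b\<close> by (auto simp: S_def)
  ultimately have t: "Sup S \<in> S"
    by (intro closed_contains_Sup) auto
  then have "Sup S < b"
    using \<open>\<not> f b \<le> c\<close> by (cases "Sup S = b") (auto simp: S_def)
  have above: "f x > c" if "Sup S < x" "x \<le> b" for x
  proof (rule ccontr)
    assume "\<not> f x > c"
    then have "x \<in> S"
      using that t by (auto simp: S_def)
    then show False
      using cSup_upper[OF _ \<open>bdd_above S\<close>] that by fastforce
  qed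
  have "f b \<le> f (Sup S)"
  proof (rule DERIV_nonpos_imp_decreasing_open[where f = f])
    show "Sup S \<le> b"
      using \<open>Sup S < b\<close> by simp
    show "continuous_on {Sup S..b} f"
      using t by (intro continuous_on_subset[OF cont]) (auto simp: S_def)
    fix x assume "Sup S < x" "x < b"
    moreover have "a \<le> Sup S"
      using t by (simp add: S_def)
    ultimately show "\<exists>y. (f has_real_derivative y) (at x) \<and> y \<le> 0"
      using deriv[of x] decr[of x] above[of x] by auto
  qed
  then show False
    using t \<open>\<not> f b \<le> c\<close> by (auto simp: S_def)
qed

text \<open>With \<open>s = k * (e - 1)\<close>, the first term is at most
  \<open>s + s\<^sup>2\<close> once \<open>k\<close> is at least \<open>1 / 2\<close>, and
  \<open>0 \<le> s \<le> a\<close> gives \<open>s + s\<^sup>2 \<le> a + a\<^sup>2\<close>.\<close>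

lemma barrier_arith:
  fixes a e k :: real
  assumes "e \<ge> 1" "k \<ge> 1 / 2" "a \<ge> k * (e - 1)"
  shows "k / 2 * (e\<^sup>2 - 1) - a - a\<^sup>2 \<le> 0"
proof -
  have nn: "0 \<le> k * (e - 1)"
    using assms by simp
  have "(k * (e - 1))\<^sup>2 \<le> a\<^sup>2"
    using assms(3) nn by (rule power_mono)
  moreover have "k / 2 * (e\<^sup>2 - 1) = k * (e - 1) + (k * (e - 1))\<^sup>2 - k * (k - 1 / 2) * (e - 1)\<^sup>2"
    by (simp add: power2_eq_square field_simps)
  moreover have "0 \<le> k * (k - 1 / 2) * (e - 1)\<^sup>2"
    using assms by simp
  ultimately show ?thesis
    using assms(3) by linarith
qed

context static_shell
begin

lemma lam_has_derivative:
  obtains "continuous_on {0..} lam" "\<And>r. r > 0 \<Longrightarrow> (lam has_real_derivative deriv lam r) (at r)"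
proof -
  obtain l where l: "\<And>x. x \<ge> 0 \<Longrightarrow> (lam has_real_derivative l x) (at x within {0..})"
    using lam_C1 by (auto simp: One_nat_def)
  have "(lam has_real_derivative deriv lam r) (at r)" if "r > 0" for r
    using has_real_derivative_at_of_within_atLeast[OF l[of r]] that by (metis DERIV_imp_deriv less_imp_le)
  moreover have "continuous_on {0..} lam"
    using l by (auto intro!: DERIV_continuous_on)
  ultimately show ?thesis
    using that by blast
qed

text \<open>At the centre \<open>deriv \<mu>\<close> depends on unconstrained values at negative
  radii. The representative \<open>\<mu>'\<close> agrees with it for positive radii and is
  continuous up to the centre.\<close>

lemma \<mu>_has_derivative:
  obtains \<mu>' where "continuous_on {0..} \<mu>'" "\<And>r. r > 0 \<Longrightarrow> deriv \<mu> r = \<mu>' r"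
    "\<And>r. r > 0 \<Longrightarrow> (\<mu>' has_real_derivative deriv (deriv \<mu>) r) (at r)"
proof -
  obtain \<mu>' \<mu>'' where
    d1: "\<And>x. x \<ge> 0 \<Longrightarrow> (\<mu> has_real_derivative \<mu>' x) (at x within {0..})" and
    d2: "\<And>x. x \<ge> 0 \<Longrightarrow> (\<mu>' has_real_derivative \<mu>'' x) (at x within {0..})"
    using \<mu>_C2 by (auto simp: numeral_2_eq_2)
  have eq: "deriv \<mu> r = \<mu>' r" if "r > 0" for r
    using has_real_derivative_at_of_within_atLeast[OF d1[of r]] that by (auto dest: DERIV_imp_deriv)
  have "(\<mu>' has_real_derivative deriv (deriv \<mu>) r) (at r)" if "r > 0" for r
  proof -
    have D: "(\<mu>' has_real_derivative \<mu>'' r) (at r)"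
      using has_real_derivative_at_of_within_atLeast[OF d2[of r]] that by auto
    have "(deriv \<mu> has_real_derivative \<mu>'' r) (at r)"
      using D by (rule has_field_derivative_transform_within_open[where S = "{0<..}"])
        (use eq that in auto)
    then show ?thesis
      using D by (simp add: DERIV_imp_deriv)
  qed
  moreover have "continuous_on {0..} \<mu>'"
    using d2 by (auto intro!: DERIV_continuous_on)
  ultimately show ?thesis
    using that eq by blast
qed

text \<open>The density equation says that \<open>r / 2 * (1 - exp (- 2 * lam r))\<close>, the
  quasi-local mass, has derivative \<open>4 * pi * r\<^sup>2 * \<rho> r\<close>. The factor
  \<open>r\<close> makes it vanish at the centre.\<close>

lemma mass_function:
  assumes "r \<ge> 0"
  shows "((\<lambda>\<eta>. 4 * pi * \<eta>\<^sup>2 * \<rho> \<eta>) has_integral r / 2 * (1 - exp (- 2 * lam r))) {0..r}"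
proof -
  let ?m = "\<lambda>r. r / 2 * (1 - exp (- 2 * lam r))"
  obtain cont: "continuous_on {0..} lam"
    and D: "\<And>r. r > 0 \<Longrightarrow> (lam has_real_derivative deriv lam r) (at r)"
    by (rule lam_has_derivative) blast
  have "((\<lambda>\<eta>. 4 * pi * \<eta>\<^sup>2 * \<rho> \<eta>) has_integral (?m r - ?m 0)) {0..r}"
  proof (rule fundamental_theorem_of_calculus_interior)
    show "continuous_on {0..r} ?m"
      by (intro continuous_intros continuous_on_subset[OF cont]) auto
    fix x assume "x \<in> {0<..<r}"
    then have "x > 0"
      by simp
    have "(?m has_real_derivative
        (1 - exp (- 2 * lam x)) / 2 + x * deriv lam x * exp (- 2 * lam x)) (at x)"
      by (rule derivative_eq_intros refl D \<open>x > 0\<close> | simp)+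
    moreover have "(1 - exp (- 2 * lam x)) / 2 + x * deriv lam x * exp (- 2 * lam x)
        = 4 * pi * x\<^sup>2 * \<rho> x"
      using einstein_\<rho>[OF \<open>x > 0\<close>] by argo
    ultimately show "(?m has_vector_derivative 4 * pi * x\<^sup>2 * \<rho> x) (at x)"
      by (simp add: has_real_derivative_iff_has_vector_derivative)
  qed (use assms in auto)
  then show ?thesis
    by simp
qed

lemma adm_mass_eq:
  assumes "r \<ge> R1"
  shows "adm_mass \<rho> = r / 2 * (1 - exp (- 2 * lam r))"
proof -
  have "((\<lambda>\<eta>. 4 * pi * \<eta>\<^sup>2 * \<rho> \<eta>) has_integral r / 2 * (1 - exp (- 2 * lam r))) {0..}"
    by (rule has_integral_eq[OF _ iffD2[OF has_integral_restrict mass_function]])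
      (use assms radii matter_support in auto)
  then show ?thesis
    by (simp add: adm_mass_def integral_unique)
qed

lemma lam_nonneg:
  assumes "\<And>r. r \<ge> 0 \<Longrightarrow> \<rho> r \<ge> 0" "r > 0"
  shows "lam r \<ge> 0"
proof -
  have "0 \<le> r / 2 * (1 - exp (- 2 * lam r))"
    using mass_function[of r] by (rule has_integral_nonneg) (use assms in auto)
  then show ?thesis
    using \<open>r > 0\<close> by (simp add: zero_le_mult_iff)
qed

text \<open>This is the barrier estimate \<open>W \<le> k\<close>, solved for
  \<open>r * deriv \<mu> r\<close>.\<close>

lemma deriv_\<mu>_bound:
  assumes \<rho>_nonneg: "\<And>r. r \<ge> 0 \<Longrightarrow> \<rho> r \<ge> 0"
    and energy: "\<And>r. r \<ge> 0 \<Longrightarrow> p r + q r \<le> \<Omega> * \<rho> r"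
    and "\<Omega> \<ge> - 1 / 2" "r > 0"
  shows "r * deriv \<mu> r \<le> (\<Omega> + 1) * (exp (lam r) - 1)"
proof -
  define k where "k = \<Omega> + 1"
  obtain cont: "continuous_on {0..} lam"
    and D: "\<And>r. r > 0 \<Longrightarrow> (lam has_real_derivative deriv lam r) (at r)"
    by (rule lam_has_derivative) blast
  obtain \<mu>' where cont': "continuous_on {0..} \<mu>'"
    and eq: "\<And>r. r > 0 \<Longrightarrow> deriv \<mu> r = \<mu>' r"
    and D': "\<And>r. r > 0 \<Longrightarrow> (\<mu>' has_real_derivative deriv (deriv \<mu>) r) (at r)"
    by (rule \<mu>_has_derivative) blast
  define W where "W = (\<lambda>x. exp (- lam x) * (x * \<mu>' x + k))"
  define W' where "W' = (\<lambda>x. exp (- lam x) *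
    (\<mu>' x + x * deriv (deriv \<mu>) x - deriv lam x * (x * \<mu>' x + k)))"
  \<comment> \<open>This form matches the hypothesis of \<open>barrier_arith\<close>; its negation
    yields the final bound.\<close>
  have gt_iff: "W x > k \<longleftrightarrow> x * \<mu>' x > k * (exp (lam x) - 1)" for x
    by (simp add: W_def exp_minus field_simps)
  have "W r \<le> k"
  proof (rule barrier_le[where f = W and f' = W' and a = 0])
    show "continuous_on {0..} W"
      unfolding W_def by (intro continuous_intros cont cont')
    show "W 0 \<le> k"
      by (simp add: W_def regular_centre)
    show "(W has_real_derivative W' x) (at x)" if "x > 0" for x
      unfolding W_def W'_def
      by (rule derivative_eq_intros refl D D' that | simp add: algebra_simps)+
    show "W' x \<le> 0" if x: "x > 0" and gt: "W x > k" for x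
    proof -
      \<comment> \<open>In these dimensionless variables the density and pressure equations become
        linear.\<close>
      define a b E where "a = x * \<mu>' x" and "b = x * deriv lam x" and "E = exp (2 * lam x)"
      have E: "E > 0" "exp (- 2 * lam x) = 1 / E" "E = (exp (lam x))\<^sup>2"
        by (simp_all add: E_def exp_minus field_simps flip: exp_double)
      have r: "8 * pi * x\<^sup>2 * \<rho> x * E = 2 * b - 1 + E"
        using einstein_\<rho>[OF x] E(1) unfolding E(2) by (simp add: b_def field_simps)
      have p: "8 * pi * x\<^sup>2 * p x * E = 2 * a + 1 - E"
        using einstein_p[OF x] E(1) eq[OF x] unfolding E(2) by (simp add: a_def field_simps)
      have "x\<^sup>2 * (deriv (deriv \<mu>) x + (\<mu>' x - deriv lam x) * (\<mu>' x + 1 / x))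
          = x\<^sup>2 * deriv (deriv \<mu>) x + (a - b) * (a + 1)"
        using x by (simp add: a_def b_def power2_eq_square field_simps)
      then have q: "x\<^sup>2 * deriv (deriv \<mu>) x = 4 * pi * x\<^sup>2 * q x * E - (a - b) * (a + 1)"
        using einstein_q[OF x] unfolding E_def eq[OF x] by (simp add: mult_ac)
      have "8 * pi * x\<^sup>2 * E * (p x + q x) \<le> 8 * pi * x\<^sup>2 * E * (\<Omega> * \<rho> x)"
        using energy[of x] x E(1) by (intro mult_left_mono) auto
      then have "8 * pi * x\<^sup>2 * q x * E \<le> \<Omega> * (2 * b - 1 + E) - (2 * a + 1 - E)"
        unfolding r[symmetric] p[symmetric] by (simp add: algebra_simps)
      \<comment> \<open>The choice \<open>k = \<Omega> + 1\<close> is what cancels all terms in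
        \<open>b\<close>, so that no derivative of \<open>lam\<close> remains on the right.\<close>
      then have "a + x\<^sup>2 * deriv (deriv \<mu>) x - b * (a + k) \<le> k / 2 * (E - 1) - a - a\<^sup>2"
        unfolding q k_def by (simp add: field_simps power2_eq_square)
      also have "\<dots> \<le> 0"
        unfolding E(3) using gt[unfolded gt_iff] lam_nonneg[OF \<rho>_nonneg x] \<open>\<Omega> \<ge> - 1 / 2\<close>
        by (intro barrier_arith) (auto simp: a_def k_def)
      \<comment> \<open>The estimated quantity is \<open>W' x\<close> times a positive factor, so
        the sign carries over.\<close>
      also have "a + x\<^sup>2 * deriv (deriv \<mu>) x - b * (a + k) = x * (exp (lam x) * W' x)"
        by (simp add: W'_def a_def b_def power2_eq_square algebra_simps flip: exp_minus)
          (simp add: exp_minus field_simps)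
      finally show ?thesis
        using x by (simp add: mult_le_0_iff)
    qed
  qed (use \<open>r > 0\<close> in simp)
  then show ?thesis
    using gt_iff[of r] eq[OF \<open>r > 0\<close>] by (simp add: k_def)
qed

text \<open>Just outside the shell both the mass and \<open>r * deriv \<mu> r\<close> are functions
  of \<open>exp (lam r)\<close> and \<open>r\<close>, so the bound on the latter limits the
  mass.\<close>

lemma adm_mass_bound:
  assumes \<rho>_nonneg: "\<And>r. r \<ge> 0 \<Longrightarrow> \<rho> r \<ge> 0"
    and energy: "\<And>r. r \<ge> 0 \<Longrightarrow> p r + q r \<le> \<Omega> * \<rho> r"
    and "\<Omega> \<ge> 0"
  shows "2 * adm_mass \<rho> / R1 \<le> ((2 * \<Omega> + 1)\<^sup>2 - 1) / (2 * \<Omega> + 1)\<^sup>2"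
proof -
  let ?B = "((2 * \<Omega> + 1)\<^sup>2 - 1) / (2 * \<Omega> + 1)\<^sup>2"
  have exterior: "2 * adm_mass \<rho> \<le> r * ?B" if "r > R1" for r
  proof -
    have "r > 0"
      using that radii by simp
    define e where "e = exp (lam r)"
    have e: "e \<ge> 1" "exp (- 2 * lam r) = 1 / e\<^sup>2"
      using lam_nonneg[OF \<rho>_nonneg \<open>r > 0\<close>]
      by (simp_all add: e_def exp_minus field_simps flip: exp_double)
    \<comment> \<open>The radial pressure equation with \<open>p r = 0\<close>.\<close>
    have "(e\<^sup>2 - 1) / 2 = r * deriv \<mu> r"
      using einstein_p[OF \<open>r > 0\<close>] matter_support[of r] that radii e(1) unfolding e(2)
      by (simp add: field_simps)
    also have "\<dots> \<le> (\<Omega> + 1) * (e - 1)"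
      unfolding e_def by (rule deriv_\<mu>_bound) (use assms \<open>r > 0\<close> in auto)
    finally have "(e - 1) * (e - (2 * \<Omega> + 1)) \<le> 0"
      by (simp add: field_simps power2_eq_square)
    \<comment> \<open>Either \<open>e = 1\<close>, where \<open>\<Omega> \<ge> 0\<close> suffices,
      or the positive factor \<open>e - 1\<close> can be divided out.\<close>
    then have "e \<le> 2 * \<Omega> + 1"
      using e(1) \<open>\<Omega> \<ge> 0\<close> by (auto simp: mult_le_0_iff)
    then have "e\<^sup>2 \<le> (2 * \<Omega> + 1)\<^sup>2"
      using e(1) by (intro power_mono) auto
    then have "1 - 1 / e\<^sup>2 \<le> 1 - 1 / (2 * \<Omega> + 1)\<^sup>2"
      using e(1) \<open>\<Omega> \<ge> 0\<close>
      by (intro diff_left_mono divide_left_mono mult_pos_pos zero_less_power) auto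
    also have "\<dots> = ?B"
      using \<open>\<Omega> \<ge> 0\<close> by (simp add: diff_divide_distrib)
    finally have "r * (1 - 1 / e\<^sup>2) \<le> r * ?B"
      using \<open>r > 0\<close> by (intro mult_left_mono) auto
    then show ?thesis
      using adm_mass_eq[of r] that e(2) by simp
  qed
  \<comment> \<open>The support assumption gives vacuum only for \<open>r > R1\<close>. As the mass
    does not depend on \<open>r\<close>, letting \<open>r\<close> decrease to \<open>R1\<close>
    gives the bound there.\<close>
  have "2 * adm_mass \<rho> \<le> R1 * ?B"
  proof (rule tendsto_lowerbound)
    show "((\<lambda>r. r * ?B) \<longlongrightarrow> R1 * ?B) (at_right R1)"
      by (intro tendsto_intros)
    show "\<forall>\<^sub>F r in at_right R1. 2 * adm_mass \<rho> \<le> r * ?B"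
      using exterior by (auto simp: eventually_at_filter)
  qed simp
  then show ?thesis
    using radii by (simp add: pos_divide_le_eq mult.commute)
qed

end

theorem theorem2:
  fixes \<Omega> :: real
    and R0 R1 :: "nat \<Rightarrow> real"
    and \<rho> p q lam \<mu> :: "nat \<Rightarrow> real \<Rightarrow> real"
  assumes "\<Omega> \<ge> 1"
    and "\<And>j. static_shell (R0 j) (R1 j) (\<rho> j) (p j) (q j) (lam j) (\<mu> j)"
    and "\<And>j r. r \<ge> 0 \<Longrightarrow> \<rho> j r \<ge> 0"
    and "\<And>j r. r \<ge> 0 \<Longrightarrow> p j r \<ge> 0"
    and "\<And>j r. r \<ge> 0 \<Longrightarrow> p j r + q j r \<le> \<Omega> * \<rho> j r"
    and "(\<lambda>j. R1 j / R0 j) \<longlonglongrightarrow> 1"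
  shows "limsup (\<lambda>j. ereal (2 * adm_mass (\<rho> j) / R1 j))
           \<le> ereal (((2 * \<Omega> + 1)\<^sup>2 - 1) / (2 * \<Omega> + 1)\<^sup>2)"
\<comment> \<open>The bound holds for each shell separately, and the limsup inherits it.\<close>
proof (rule Limsup_bounded, rule always_eventually, rule allI)
  fix j
  interpret static_shell "R0 j" "R1 j" "\<rho> j" "p j" "q j" "lam j" "\<mu> j"
    by (rule assms(2))
  show "ereal (2 * adm_mass (\<rho> j) / R1 j) \<le> ereal (((2 * \<Omega> + 1)\<^sup>2 - 1) / (2 * \<Omega> + 1)\<^sup>2)"
    using adm_mass_bound[of \<Omega>] assms(1,3,5) by simp
qed

end
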